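(* Let $Y$ be a mean zero random variable with variance $\sigma^2>0$ and moment generating function $m(s)=\mathbb{E}[e^{sY}]$, and let $Y^*$ have the approximate $Y$-zero bias distribution, i.e. $Y^*$ satisfies $$\mathbb{E}[Yf(Y)]=\sigma^2\,\mathbb{E}f'(Y^* )-\frac{\mathbb{E}[YR]}{\lambda}\,\mathbb{E}f'(Y^* )+\frac{\mathbb{E}[Rf(Y)]}{\lambda}$$ for all absolutely continuous functions $f$, with $R=R(Y)$ and $0<\lambda<1$. Let $B_1=\mathbb{E}|R|/\lambda$ if $|R|$ and $e^{sY}$ are negatively correlated for $0<s<\alpha$, where $\alpha$ is given differently for each bound below, and $B_1=\mathrm{ess\,sup}\,|\mathbb{E}[R\mid Y]|/\lambda$ otherwise; and let $B_2=|\mathbb{E}(YR)|/\lambda$. Assume that $B_1$ and $B_2$ are finite. (a) If $Y^*-Y\le c$ for some $c>0$ and $m(s)$ exists for all $s\in[0,\alpha)$ with $\alpha=1/c$, then for all $t>0$ $$P(Y\ge t)\le\exp\left(-\frac{t(t-2B_1)}{2(\sigma^2+B_2+ct)}\right).$$ The same upper bound holds for $P(Y\le -t)$ if $Y-Y^*\le c$ when $m(s)$ exists for all $s\in(-\alpha,0]$. If $|Y^*-Y|\le c$ for some $c>0$ and $m(s)$ exists for all $s\in[0,\alpha)$ with $\alpha=2/c$, then for all $t>0$ $$P(Y\ge t)\le\exp\left(-\frac{t(t-2B_1)}{10(\sigma^2+B_2)/3+ct}\right),$$ with the same upper bound for $P(Y\le -t)$ if $Y-Y^*\le c$ and $m(s)$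 exists in $(-\alpha,0]$. (b) If $Y^*-Y\le c$ for some $c>0$ and $m(s)$ exists at $\alpha=(\log(t-B_1)-\log\log(t-B_1))/c$, then for $t>B_1$, $$P(Y\ge t)\le\exp\left(-\frac{t-B_1}{c}\left(\log(t-B_1)-\log\log(t-B_1)-\frac{\sigma^2+B_2}{c}\right)\right)\le\exp\left(-\frac{t-B_1}{2c}\left(\log(t-B_1)-\frac{2(\sigma^2+B_2)}{c}\right)\right).$$ If $Y-Y^*\le c$, then the same bound holds for the left tail $P(Y\le -t)$ when $m(-\alpha)<\infty$.
   Context: $Y$ and $Y^*$ are real random variables defined on the same probability space, and $R=R(Y)$ is a random variable that is a function of $Y$. "$m(s)$ exists" means $m(s)<\infty$.
   Formalization: In (b) the first inequality is claimed only for t−B1 ≥ e^{1/2} (it fails for t−B1 near 1) and the second for t−B1>1; P ≤ the last bound holds for all t>B1. For left tails, negative correlation of |R| and e^{sY} is required for −α<s<0, as the range 0<s<α makes the claim false. *)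

theory Defs
  imports "HOL-Probability.Probability"
begin

definition absolutely_continuous_on_interval :: "(real \<Rightarrow> real) \<Rightarrow> real \<Rightarrow> real \<Rightarrow> bool" where
  "absolutely_continuous_on_interval f a b \<longleftrightarrow>
     (\<forall>\<epsilon>>0. \<exists>\<delta>>0. \<forall>D :: (real \<times> real) set.
        finite D \<and> (\<forall>(u, v)\<in>D. a \<le> u \<and> u \<le> v \<and> v \<le> b) \<and>
        disjoint_family_on (\<lambda>(u, v). {u<..<v}) D \<and> (\<Sum>(u, v)\<in>D. v - u) < \<delta>
        \<longrightarrow> (\<Sum>(u, v)\<in>D. \<bar>f v - f u\<bar>) < \<epsilon>)"

text \<open>
  As usual for zero bias distributions, a function on the whole line is called absolutely
  continuous if it is so on every compact interval (exponential functions have to be admitted).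
\<close>
definition locally_absolutely_continuous :: "(real \<Rightarrow> real) \<Rightarrow> bool" where
  "locally_absolutely_continuous f \<longleftrightarrow> (\<forall>a b. absolutely_continuous_on_interval f a b)"

text \<open>
  The identity is required for all absolutely continuous \<open>f\<close> for which the expectations in it
  exist.  The derivative \<open>deriv f\<close> is arbitrary on the Lebesgue null set where \<open>f\<close> is not
  differentiable.  This is harmless: if the total coefficient of \<open>E f'(Ys)\<close> is nonzero, the
  identity forces \<open>Ys\<close> to have a Lebesgue density; if it is zero, \<open>E f'(Ys)\<close> drops out.
\<close>
definition approx_zero_bias ::
  "'a measure \<Rightarrow> ('a \<Rightarrow> real) \<Rightarrow> ('a \<Rightarrow> real) \<Rightarrow> real \<Rightarrow> real \<Rightarrow> ('a \<Rightarrow> real) \<Rightarrow> bool" where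
  "approx_zero_bias M Y R \<sigma> l Ys \<longleftrightarrow>
     (\<forall>f. locally_absolutely_continuous f \<and>
          integrable M (\<lambda>\<omega>. Y \<omega> * f (Y \<omega>)) \<and>
          integrable M (\<lambda>\<omega>. deriv f (Ys \<omega>)) \<and>
          integrable M (\<lambda>\<omega>. R \<omega> * f (Y \<omega>))
        \<longrightarrow> (\<integral>\<omega>. Y \<omega> * f (Y \<omega>) \<partial>M) =
              \<sigma>\<^sup>2 * (\<integral>\<omega>. deriv f (Ys \<omega>) \<partial>M)
              - (\<integral>\<omega>. Y \<omega> * R \<omega> \<partial>M) / l * (\<integral>\<omega>. deriv f (Ys \<omega>) \<partial>M)
              + (\<integral>\<omega>. R \<omega> * f (Y \<omega>) \<partial>M) / l)"

definition mgf :: "'a measure \<Rightarrow> ('a \<Rightarrow> real) \<Rightarrow> real \<Rightarrow> ennreal" where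
  "mgf M Y s = (\<integral>\<^sup>+\<omega>. ennreal (exp (s * Y \<omega>)) \<partial>M)"

definition covariance :: "'a measure \<Rightarrow> ('a \<Rightarrow> real) \<Rightarrow> ('a \<Rightarrow> real) \<Rightarrow> real" where
  "covariance M U V = (\<integral>\<omega>. (U \<omega> - (\<integral>x. U x \<partial>M)) * (V \<omega> - (\<integral>x. V x \<partial>M)) \<partial>M)"

text \<open>Zero covariance is allowed, the weaker of the two usual readings.\<close>
definition negatively_correlated :: "'a measure \<Rightarrow> ('a \<Rightarrow> real) \<Rightarrow> ('a \<Rightarrow> real) \<Rightarrow> bool" where
  "negatively_correlated M U V \<longleftrightarrow>
     integrable M U \<and> integrable M V \<and> integrable M (\<lambda>\<omega>. U \<omega> * V \<omega>) \<and> covariance M U V \<le> 0"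

text \<open>
  \<open>S\<close> is the range of \<open>s\<close> over which \<open>|R|\<close> and \<open>exp (s Y)\<close> have to be negatively correlated:
  the interval from \<open>0\<close> to \<open>\<alpha>\<close> for right tails, and its mirror image from \<open>-\<alpha>\<close> to \<open>0\<close> for left
  tails, which are the right tails of \<open>-Y\<close>.  The value is extended real; \<open>\<infinity>\<close> is possible.
\<close>
definition B1 ::
  "'a measure \<Rightarrow> ('a \<Rightarrow> real) \<Rightarrow> ('a \<Rightarrow> real) \<Rightarrow> real \<Rightarrow> real set \<Rightarrow> ennreal" where
  "B1 M Y R l S =
     (if \<forall>s\<in>S. negatively_correlated M (\<lambda>\<omega>. \<bar>R \<omega>\<bar>) (\<lambda>\<omega>. exp (s * Y \<omega>))
      then (\<integral>\<^sup>+\<omega>. ennreal \<bar>R \<omega>\<bar> \<partial>M) / ennreal l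
      else esssup M (\<lambda>\<omega>. ennreal \<bar>real_cond_exp M (vimage_algebra (space M) Y borel) R \<omega>\<bar>) / ennreal l)"

text \<open>Meaningful only if \<open>Y R\<close> is integrable.\<close>
definition B2 :: "'a measure \<Rightarrow> ('a \<Rightarrow> real) \<Rightarrow> ('a \<Rightarrow> real) \<Rightarrow> real \<Rightarrow> real" where
  "B2 M Y R l = \<bar>\<integral>\<omega>. Y \<omega> * R \<omega> \<partial>M\<bar> / l"

text \<open>
  The two bounds with logarithms, as functions of \<open>x = t - B1\<close> and \<open>K = \<sigma>\<^sup>2 + B2\<close>.  The
  expressions \<open>log_alpha\<close> and \<open>log_bound\<close> are mathematically defined for \<open>x > 1\<close> only, since they
  contain \<open>log log x\<close>; outside that range the values below are artefacts of the totality of \<open>ln\<close>.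
  As \<open>x\<close> decreases to \<open>1\<close>, \<open>log_bound c K x\<close> tends to \<open>0\<close>, so it cannot bound tail
  probabilities there; \<open>log_bound_weak\<close> can, for every \<open>x > 0\<close>.
\<close>
definition log_alpha :: "real \<Rightarrow> real \<Rightarrow> real" where
  "log_alpha c x = (ln x - ln (ln x)) / c"

definition log_bound :: "real \<Rightarrow> real \<Rightarrow> real \<Rightarrow> real" where
  "log_bound c K x = exp (- (x / c) * (ln x - ln (ln x) - K / c))"

definition log_bound_weak :: "real \<Rightarrow> real \<Rightarrow> real \<Rightarrow> real" where
  "log_bound_weak c K x = exp (- (x / (2 * c)) * (ln x - 2 * K / c))"

end

theory Submission
  imports Defs
begin

text \<open>
  The zero bias identity for \<open>f x = exp (s * x)\<close> expresses the derivative of the moment generating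
  function \<open>m\<close> of \<open>Y\<close>:
  \<open>m' s = (\<sigma>\<^sup>2 - E (Y R) / \<lambda>) * s * E exp (s * Ys) + E (R * exp (s * Y)) / \<lambda>\<close>.
  The coefficient is at most \<open>K = \<sigma>\<^sup>2 + B2\<close> in absolute value, and \<open>Ys \<le> Y + c\<close> gives
  \<open>E exp (s * Ys) \<le> exp (c * s) * m s\<close>.  The quantity \<open>B1\<close> is made for the last term, which it
  bounds by \<open>B1 * m s\<close> (lemma \<open>expectation_mult_exp_le_B1\<close>).  Hence
  \<open>(ln m)' s \<le> K * s * exp (c * s) + B1\<close>, and integrating from \<open>0\<close>, where \<open>m\<close> is \<open>1\<close>, followed by
  Markov's inequality bounds the right tail by
  \<open>exp (- s * t + B1 * s + K * id_exp_integral (c * s) / c\<^sup>2)\<close>, where \<open>id_exp_integral x\<close> is the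
  integral of \<open>u * exp u\<close> over \<open>[0, x]\<close>, for every \<open>s\<close> in the range where \<open>m\<close> and \<open>B1\<close> are under
  control (lemma \<open>exponential_tail_bound\<close>).

  The integration works with increments of \<open>ln m\<close> instead of its derivative.  Convexity of \<open>ln m\<close>
  bounds an increment by the slope at the right end (lemma \<open>ln_mgf_diff_le\<close>), and since the slope bound increases
  in \<open>s\<close>, summing over a grid and refining it gives the integral (lemma
  \<open>telescoping_upper_bound\<close>).

  Every bound is a choice of \<open>s\<close> in this single family.  For the Bernstein bounds \<open>id_exp_integral\<close> is
  replaced by a rational majorant, with a pole at \<open>1\<close> or, using the Pade approximant of \<open>exp\<close>, at \<open>2\<close>; the
  pole determines the admissible range of \<open>s\<close>.  For the logarithmic bounds \<open>s\<close> is \<open>log_alpha\<close>, or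
  half of \<open>ln (t - B1) / c\<close> for the weaker form.  Left tails are right tails of \<open>-Y\<close>, since the
  identity for \<open>exp (- s * x)\<close> is the one for \<open>exp (s * x)\<close> after changing the signs of \<open>Y\<close>, \<open>Ys\<close>
  and \<open>R\<close>.
\<close>

section \<open>Elementary inequalities\<close>

text \<open>
  The integral of \<open>u * exp u\<close> over \<open>[0, x]\<close>.  The growth rate of the logarithm of the moment
  generating function contains \<open>s * exp (c * s)\<close>, whose primitive vanishing at \<open>0\<close> is
  \<open>id_exp_integral (c * s) / c\<^sup>2\<close>.
\<close>
definition id_exp_integral :: "real \<Rightarrow> real" where
  "id_exp_integral x = (x - 1) * exp x + 1"

lemma le_from_deriv_le:
  fixes f g f' g' :: "real \<Rightarrow> real"
  assumes "0 \<le> x" and "f 0 \<le> g 0"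
    and "\<And>y. 0 \<le> y \<Longrightarrow> y \<le> x \<Longrightarrow> (f has_real_derivative f' y) (at y)"
    and "\<And>y. 0 \<le> y \<Longrightarrow> y \<le> x \<Longrightarrow> (g has_real_derivative g' y) (at y)"
    and "\<And>y. 0 \<le> y \<Longrightarrow> y \<le> x \<Longrightarrow> f' y \<le> g' y"
  shows "f x \<le> g x"
proof -
  have "g 0 - f 0 \<le> g x - f x"
  proof (rule DERIV_nonneg_imp_nondecreasing[OF assms(1)])
    fix y assume y: "0 \<le> y" "y \<le> x"
    have "((\<lambda>y. g y - f y) has_real_derivative (g' y - f' y)) (at y)"
      using assms(3,4)[OF y] by (intro derivative_intros)
    with assms(5)[OF y] show "\<exists>d. ((\<lambda>y. g y - f y) has_real_derivative d) (at y) \<and> 0 \<le> d"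
      by force
  qed
  with assms(2) show ?thesis by simp
qed

lemma DERIV_id_exp_integral: "(id_exp_integral has_real_derivative x * exp x) (at x)"
  unfolding id_exp_integral_def [abs_def] by (auto intro!: derivative_eq_intros simp: algebra_simps)

text \<open>
  By \<open>exp y \<le> 1 / (1 - y)\<close> the integrand is below the derivative of the right-hand side.  A majorant
  of the form \<open>x\<^sup>2 / (1 - x)\<close> is the one whose optimisation in \<open>s\<close> yields a Bernstein bound.
\<close>
lemma id_exp_integral_le_quadratic:
  assumes "0 \<le> x" "x < 1"
  shows "id_exp_integral x \<le> x\<^sup>2 / (2 * (1 - x))"
proof (rule le_from_deriv_le[OF assms(1)])
  fix y assume y: "0 \<le> y" "y \<le> x"
  show "(id_exp_integral has_real_derivative y * exp y) (at y)" by (rule DERIV_id_exp_integral)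
  have y1: "y < 1" using y assms by simp
  show "((\<lambda>y. y\<^sup>2 / (2 * (1 - y))) has_real_derivative y * ((1 - y / 2) / (1 - y)\<^sup>2)) (at y)"
  proof (rule DERIV_cong)
    show "((\<lambda>y. y\<^sup>2 / (2 * (1 - y))) has_real_derivative
        (2 * y * (2 * (1 - y)) + y\<^sup>2 * 2) / (2 * (1 - y) * (2 * (1 - y)))) (at y)"
      using y1 by (auto intro!: derivative_eq_intros)
    show "(2 * y * (2 * (1 - y)) + y\<^sup>2 * 2) / (2 * (1 - y) * (2 * (1 - y))) = y * ((1 - y / 2) / (1 - y)\<^sup>2)"
      using y1 by (simp add: divide_simps) algebra
  qed
  have "exp y \<le> 1 / (1 - y)"
    using exp_ge_add_one_self[of "-y"] y1 by (simp add: exp_minus field_simps)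
  also have "\<dots> = (1 - y) / (1 - y)\<^sup>2" using y1 by (simp add: power2_eq_square)
  also have "\<dots> \<le> (1 - y / 2) / (1 - y)\<^sup>2" using y by (intro divide_right_mono) auto
  finally show "y * exp y \<le> y * ((1 - y / 2) / (1 - y)\<^sup>2)" using y by (intro mult_left_mono) auto
qed (simp add: id_exp_integral_def)

text \<open>
  The right-hand side is the Pade approximant of type (1, 1) of \<open>exp\<close>.  It is singular exactly at
  \<open>x = 2\<close>, which is the source of the larger range \<open>s < 2 / c\<close> in the second Bernstein bound.
\<close>
lemma exp_le_pade:
  fixes x :: real
  assumes "0 \<le> x" "x < 2"
  shows "exp x \<le> (2 + x) / (2 - x)"
proof -
  have "(2 - x) * exp x \<le> 2 + x"
  proof (rule le_from_deriv_le[OF assms(1), where g = "\<lambda>y. 2 + y"])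
    fix y assume y: "0 \<le> y" "y \<le> x"
    show "((\<lambda>y. (2 - y) * exp y) has_real_derivative (1 - y) * exp y) (at y)"
      by (auto intro!: derivative_eq_intros simp: algebra_simps)
    show "((\<lambda>y. 2 + y) has_real_derivative 1) (at y)"
      by (auto intro!: derivative_eq_intros)
    have "1 - y \<le> exp (- y)" using exp_ge_add_one_self[of "-y"] by simp
    then show "(1 - y) * exp y \<le> 1" by (simp add: exp_minus field_simps)
  qed simp
  then show ?thesis using assms by (simp add: field_simps)
qed

text \<open>
  The constant \<open>5 / 3\<close> is not sharp: after differentiation the claim becomes
  \<open>(2 + y) * (2 - y) \<le> 5 / 3 * (4 - y)\<close>, a quadratic without real zeros.
\<close>
lemma id_exp_integral_le_quadratic_pade:
  assumes "0 \<le> x" "x < 2"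
  shows "id_exp_integral x \<le> 5 / 3 * (x\<^sup>2 / (2 - x))"
proof (rule le_from_deriv_le[OF assms(1)])
  fix y assume y: "0 \<le> y" "y \<le> x"
  show "(id_exp_integral has_real_derivative y * exp y) (at y)" by (rule DERIV_id_exp_integral)
  have y1: "y < 2" using y assms by simp
  show "((\<lambda>y. 5 / 3 * (y\<^sup>2 / (2 - y))) has_real_derivative y * (5 / 3 * (4 - y) / (2 - y)\<^sup>2)) (at y)"
  proof (rule DERIV_cong)
    show "((\<lambda>y. 5 / 3 * (y\<^sup>2 / (2 - y))) has_real_derivative
        5 / 3 * ((2 * y * (2 - y) + y\<^sup>2) / ((2 - y) * (2 - y)))) (at y)"
      using y1 by (intro DERIV_cmult) (auto intro!: derivative_eq_intros)
    show "5 / 3 * ((2 * y * (2 - y) + y\<^sup>2) / ((2 - y) * (2 - y))) = y * (5 / 3 * (4 - y) / (2 - y)\<^sup>2)"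
      using y1 by (simp add: divide_simps) algebra
  qed
  have "exp y \<le> (2 + y) / (2 - y)" by (rule exp_le_pade) (use y y1 in auto)
  also have "\<dots> = (2 + y) * (2 - y) / (2 - y)\<^sup>2" using y1 by (simp add: power2_eq_square)
  also have "(2 + y) * (2 - y) \<le> 5 / 3 * (4 - y)"
    using zero_le_power2[of "y - 5 / 6"] by (simp add: power2_eq_square algebra_simps)
  finally have "exp y \<le> 5 / 3 * (4 - y) / (2 - y)\<^sup>2" using y1 by (simp add: divide_right_mono)
  then show "y * exp y \<le> y * (5 / 3 * (4 - y) / (2 - y)\<^sup>2)" using y by (intro mult_left_mono) auto
qed (simp add: id_exp_integral_def)

text \<open>
  This inequality decides from which \<open>x\<close> on the sharp logarithmic bound follows from the
  exponential bound at \<open>log_alpha\<close>; there it is used for \<open>ln x\<close> instead of \<open>x\<close>.  The difference of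
  the two sides increases, so that only \<open>x = 1 / 2\<close> has to be checked.  The margin at that point is
  about \<open>0.004\<close>.
\<close>
lemma x_exp_minus_le_one_plus_ln:
  fixes x :: real
  assumes "1 / 2 \<le> x"
  shows "x * exp (- x) \<le> 1 + ln x"
proof -
  \<comment> \<open>The quadratic Taylor polynomial is too weak at \<open>1 / 2\<close>, so it is taken at \<open>1 / 4\<close> and squared.\<close>
  have "1 + 1 / 4 + (1 / 4)\<^sup>2 / 2 \<le> exp (1 / 4 :: real)" by (rule exp_lower_Taylor_quadratic) simp
  then have "(1 + 1 / 4 + (1 / 4)\<^sup>2 / 2)\<^sup>2 \<le> (exp (1 / 4 :: real))\<^sup>2" by (rule power_mono) simp
  then have "18 / 11 \<le> exp (1 / 2 :: real)" by (simp add: power2_eq_square flip: exp_add)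
  then have "1 / 2 * exp (- (1 / 2)) \<le> (11 / 36 :: real)" by (simp add: exp_minus field_simps)
  also have "\<dots> \<le> 1 + ln (1 / 2 :: real)" using ln2_le_25_over_36 by (simp add: ln_div)
  finally have half: "1 / 2 * exp (- (1 / 2)) \<le> 1 + ln (1 / 2 :: real)" .
  have "1 + ln (1 / 2) - 1 / 2 * exp (- (1 / 2)) \<le> 1 + ln x - x * exp (- x)"
  proof (rule DERIV_nonneg_imp_nondecreasing[OF assms])
    fix y :: real assume y: "1 / 2 \<le> y" "y \<le> x"
    have "((\<lambda>y. 1 + ln y - y * exp (- y)) has_real_derivative (1 / y - (1 - y) * exp (- y))) (at y)"
      using y by (auto intro!: derivative_eq_intros simp: field_simps)
    moreover have "(1 - y) * exp (- y) \<le> 1 / y"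
    proof -
      have "(1 - y) * (y * exp (- y)) \<le> 1 * (y * exp (- y))"
        using y by (intro mult_right_mono) auto
      also have "\<dots> \<le> 1"
        using order_trans[OF _ exp_ge_add_one_self[of y]] by (simp add: exp_minus field_simps)
      finally have "(1 - y) * exp (- y) * y \<le> 1" by (simp only: mult_ac)
      then show ?thesis using y by (simp add: pos_le_divide_eq)
    qed
    ultimately show "\<exists>d. ((\<lambda>y. 1 + ln y - y * exp (- y)) has_real_derivative d) (at y) \<and> 0 \<le> d"
      by force
  qed
  with half show ?thesis by simp
qed

text \<open>
  The integrated form of the differential inequality \<open>F' \<le> g\<close>, derived from increments of \<open>F\<close>
  instead of its derivative.  On an equidistant grid the increments of \<open>F\<close> are
  bounded by the terms of an upper Riemann sum, and since \<open>g\<close> increases, each of these is at most the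
  integral of \<open>g\<close> over the next grid interval.  The sum telescopes, and the shift by one step
  disappears in the limit.
\<close>
lemma telescoping_upper_bound:
  fixes F g G :: "real \<Rightarrow> real"
  assumes S: "0 \<le> S"
    and F: "\<And>u s. 0 \<le> u \<Longrightarrow> u < s \<Longrightarrow> s \<le> S \<Longrightarrow> F s - F u \<le> (s - u) * g s"
    and G: "\<And>s. 0 \<le> s \<Longrightarrow> (G has_real_derivative g s) (at s)"
    and g: "\<And>u s. 0 \<le> u \<Longrightarrow> u \<le> s \<Longrightarrow> g u \<le> g s"
  shows "F S - F 0 \<le> G S - G 0"
proof (cases "S = 0")
  case False
  with S have "0 < S" by simp
  have G_step: "h * g s \<le> G (s + h) - G s" if "0 \<le> s" "0 \<le> h" for s h
  proof -
    have "h * g s + G s \<le> G (s + h)"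
    proof (rule le_from_deriv_le[of h "\<lambda>h. h * g s + G s" "\<lambda>h. G (s + h)" "\<lambda>h. g s" "\<lambda>h. g (s + h)"])
      fix y :: real assume "0 \<le> y"
      with that have "(G has_real_derivative g (s + y)) (at (s + y))" by (intro G) auto
      then show "((\<lambda>h. G (s + h)) has_real_derivative g (s + y)) (at y)"
        using DERIV_shift[of G "g (s + y)" y s] by (simp add: add.commute)
    qed (use that in \<open>auto intro!: derivative_eq_intros g\<close>)
    then show ?thesis by simp
  qed
  have "F S - F 0 \<le> G (S + S / real (Suc n)) - G (S / real (Suc n))" for n
  proof -
    define h where "h = S / real (Suc n)"
    have h: "h > 0" "real (Suc n) * h = S" using \<open>0 < S\<close> by (auto simp: h_def)
    have "F (real k * h) - F 0 \<le> G (real (Suc k) * h) - G h" if "k \<le> Suc n" for k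
      using that
    proof (induction k)
      case (Suc k)
      have "real (Suc k) * h \<le> S" using Suc.prems h by (metis mult_right_mono of_nat_mono less_imp_le)
      then have "F (real (Suc k) * h) - F (real k * h) \<le> h * g (real (Suc k) * h)"
        using F[of "real k * h" "real (Suc k) * h"] h by (simp add: algebra_simps)
      also have "\<dots> \<le> G (real (Suc k) * h + h) - G (real (Suc k) * h)"
        using h by (intro G_step) auto
      finally show ?case using Suc by (simp add: algebra_simps)
    qed simp
    moreover have "real (Suc (Suc n)) * h = S + h" using h by (simp add: algebra_simps)
    ultimately show ?thesis using h unfolding h_def[symmetric] by (metis order_refl)
  qed
  moreover have "(\<lambda>n. G (S + S / real (Suc n)) - G (S / real (Suc n))) \<longlonglongrightarrow> G (S + 0) - G 0"
  proof -
    have *: "(\<lambda>n. S / real (Suc n)) \<longlonglongrightarrow> 0"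
      using LIMSEQ_Suc[OF lim_const_over_n[of S]] by simp
    have "isCont G S" "isCont G 0" using G S DERIV_isCont by blast+
    then show ?thesis
      by (intro tendsto_intros isCont_tendsto_compose[where g = G] *) (auto intro!: tendsto_eq_intros *)
  qed
  ultimately show ?thesis by (intro LIMSEQ_le_const) auto
qed simp

section \<open>Exponential functions in the zero bias identity\<close>

text \<open>
  On a compact interval \<open>f'\<close> is bounded, so that \<open>f\<close> is Lipschitz continuous there.
\<close>
lemma locally_absolutely_continuous_if_DERIV:
  assumes f: "\<And>x. (f has_real_derivative f' x) (at x)" and f': "continuous_on UNIV f'"
  shows "locally_absolutely_continuous f"
  unfolding locally_absolutely_continuous_def absolutely_continuous_on_interval_def
proof (intro allI impI)
  fix a b \<epsilon> :: real assume "\<epsilon> > 0"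
  have "compact (f' ` {a..b})"
    by (intro compact_continuous_image continuous_on_subset[OF f']) auto
  then obtain C where C: "C > 0" "\<And>x. x \<in> {a..b} \<Longrightarrow> \<bar>f' x\<bar> \<le> C"
    using compact_imp_bounded bounded_pos by (metis image_eqI real_norm_def)
  have lip: "\<bar>f v - f u\<bar> \<le> C * (v - u)" if uv: "a \<le> u" "u \<le> v" "v \<le> b" for u v
  proof (cases "u = v")
    case False
    then obtain z where z: "u < z" "z < v" "f v - f u = (v - u) * f' z"
      using MVT2[of u v f f'] f uv by (metis order_less_le)
    then have "\<bar>f v - f u\<bar> = \<bar>f' z\<bar> * (v - u)" using uv by (simp add: abs_mult)
    also have "\<dots> \<le> C * (v - u)" using z uv by (intro mult_right_mono C) auto
    finally show ?thesis .
  qed simp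
  show "\<exists>\<delta>>0. \<forall>D. finite D \<and> (\<forall>(u, v)\<in>D. a \<le> u \<and> u \<le> v \<and> v \<le> b) \<and>
      disjoint_family_on (\<lambda>(u, v). {u<..<v}) D \<and> (\<Sum>(u, v)\<in>D. v - u) < \<delta> \<longrightarrow>
      (\<Sum>(u, v)\<in>D. \<bar>f v - f u\<bar>) < \<epsilon>"
  proof (intro exI[of _ "\<epsilon> / C"] conjI allI impI; (elim conjE)?)
    fix D :: "(real \<times> real) set"
    assume D: "\<forall>(u, v)\<in>D. a \<le> u \<and> u \<le> v \<and> v \<le> b" "(\<Sum>(u, v)\<in>D. v - u) < \<epsilon> / C"
    have "(\<Sum>(u, v)\<in>D. \<bar>f v - f u\<bar>) \<le> (\<Sum>(u, v)\<in>D. C * (v - u))"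
      using D(1) lip by (intro sum_mono) auto
    also have "\<dots> = C * (\<Sum>(u, v)\<in>D. v - u)" by (simp add: sum_distrib_left case_prod_unfold)
    also have "\<dots> < \<epsilon>" using D(2) C(1) by (simp add: field_simps)
    finally show "(\<Sum>(u, v)\<in>D. \<bar>f v - f u\<bar>) < \<epsilon>" .
  qed (use \<open>\<epsilon> > 0\<close> C in auto)
qed

lemma approx_zero_bias_exp:
  assumes "approx_zero_bias M Y R \<sigma> l Ys"
    and "integrable M (\<lambda>\<omega>. Y \<omega> * exp (s * Y \<omega>))"
    and "integrable M (\<lambda>\<omega>. exp (s * Ys \<omega>))"
    and "integrable M (\<lambda>\<omega>. R \<omega> * exp (s * Y \<omega>))"
  shows "(\<integral>\<omega>. Y \<omega> * exp (s * Y \<omega>) \<partial>M) =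
    (\<sigma>\<^sup>2 - (\<integral>\<omega>. Y \<omega> * R \<omega> \<partial>M) / l) * (s * (\<integral>\<omega>. exp (s * Ys \<omega>) \<partial>M))
      + (\<integral>\<omega>. R \<omega> * exp (s * Y \<omega>) \<partial>M) / l"
proof -
  have D: "((\<lambda>x. exp (s * x)) has_real_derivative s * exp (s * x)) (at x)" for x
    by (auto intro!: derivative_eq_intros)
  then have deriv: "deriv (\<lambda>x. exp (s * x)) = (\<lambda>x. s * exp (s * x))"
    by (intro ext DERIV_imp_deriv)
  have "locally_absolutely_continuous (\<lambda>x. exp (s * x))"
    by (rule locally_absolutely_continuous_if_DERIV[OF D]) (intro continuous_intros)
  with assms have "(\<integral>\<omega>. Y \<omega> * exp (s * Y \<omega>) \<partial>M) =
      \<sigma>\<^sup>2 * (\<integral>\<omega>. s * exp (s * Ys \<omega>) \<partial>M)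
      - (\<integral>\<omega>. Y \<omega> * R \<omega> \<partial>M) / l * (\<integral>\<omega>. s * exp (s * Ys \<omega>) \<partial>M)
      + (\<integral>\<omega>. R \<omega> * exp (s * Y \<omega>) \<partial>M) / l"
    unfolding approx_zero_bias_def
    by (elim allE[of _ "\<lambda>x. exp (s * x)"]) (simp add: deriv)
  then show ?thesis by (simp add: algebra_simps)
qed

section \<open>The logarithm of the moment generating function\<close>

context finite_measure
begin

lemma integrable_exp_mult_mono:
  fixes Y :: "'a \<Rightarrow> real"
  assumes "Y \<in> borel_measurable M" and "integrable M (\<lambda>\<omega>. exp (s' * Y \<omega>))" and "0 \<le> s" "s \<le> s'"
  shows "integrable M (\<lambda>\<omega>. exp (s * Y \<omega>))"
proof (rule Bochner_Integration.integrable_bound)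
  show "integrable M (\<lambda>\<omega>. 1 + exp (s' * Y \<omega>))" using assms by simp
  have "exp (s * y) \<le> 1 + exp (s' * y)" for y :: real
  proof (cases "0 \<le> y")
    case True
    then have "exp (s * y) \<le> exp (s' * y)" using assms by (simp add: mult_right_mono)
    then show ?thesis by linarith
  next
    case False
    then have "exp (s * y) \<le> 1" using assms by (simp add: mult_nonneg_nonpos)
    then show ?thesis by (simp add: add_increasing2)
  qed
  then show "AE \<omega> in M. norm (exp (s * Y \<omega>)) \<le> norm (1 + exp (s' * Y \<omega>))"
    by (simp add: abs_of_pos add_pos_pos)
qed (use assms in measurable)

text \<open>
  The factor \<open>Y\<close> costs an arbitrarily small amount of the exponent: for \<open>y \<ge> 0\<close> the inequality
  \<open>(s' - s) * y \<le> exp ((s' - s) * y)\<close> absorbs it, and for \<open>y < 0\<close> the exponential is at most \<open>1\<close>.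
\<close>
lemma integrable_mult_exp:
  fixes Y :: "'a \<Rightarrow> real"
  assumes "integrable M Y" and "integrable M (\<lambda>\<omega>. exp (s' * Y \<omega>))" and "0 \<le> s" "s < s'"
  shows "integrable M (\<lambda>\<omega>. Y \<omega> * exp (s * Y \<omega>))"
proof (rule Bochner_Integration.integrable_bound)
  show "integrable M (\<lambda>\<omega>. \<bar>Y \<omega>\<bar> + exp (s' * Y \<omega>) / (s' - s))" using assms by simp
  have "\<bar>y * exp (s * y)\<bar> \<le> \<bar>y\<bar> + exp (s' * y) / (s' - s)" for y :: real
  proof (cases "0 \<le> y")
    case True
    have "(s' - s) * y \<le> exp ((s' - s) * y)"
      using exp_ge_add_one_self[of "(s' - s) * y"] by linarith
    then have "(s' - s) * y * exp (s * y) \<le> exp ((s' - s) * y) * exp (s * y)"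
      by (intro mult_right_mono) auto
    also have "\<dots> = exp (s' * y)" by (simp add: algebra_simps flip: exp_add)
    finally have "y * exp (s * y) \<le> exp (s' * y) / (s' - s)"
      using assms by (simp add: pos_le_divide_eq mult_ac)
    then show ?thesis using True by (simp add: add_increasing)
  next
    case False
    then have "\<bar>y\<bar> * exp (s * y) \<le> \<bar>y\<bar> * 1"
      using assms by (intro mult_left_mono) (auto simp: mult_nonneg_nonpos)
    then show ?thesis using assms by (simp add: abs_mult add_increasing2)
  qed
  then show "AE \<omega> in M. norm (Y \<omega> * exp (s * Y \<omega>)) \<le> norm (\<bar>Y \<omega>\<bar> + exp (s' * Y \<omega>) / (s' - s))"
    using assms by (simp add: abs_of_nonneg add_nonneg_nonneg)
qed (use assms in measurable)

end

context prob_space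
begin

lemma expectation_exp_pos:
  assumes "integrable M (\<lambda>\<omega>. exp (X \<omega> :: real))"
  shows "0 < expectation (\<lambda>\<omega>. exp (X \<omega>))"
proof -
  have "0 \<le> expectation (\<lambda>\<omega>. exp (X \<omega>))" by (intro integral_nonneg_AE) auto
  moreover have "expectation (\<lambda>\<omega>. exp (X \<omega>)) \<noteq> 0"
    using assms by (subst integral_nonneg_eq_0_iff_AE) (auto simp: AE_False)
  ultimately show ?thesis by linarith
qed

text \<open>
  The logarithm of the moment generating function \<open>m\<close> is convex, so its difference quotient to the
  left of \<open>s\<close> is at most its derivative \<open>m' s / m s\<close>, for which \<open>q\<close> is an upper bound.  The proof
  avoids derivatives: integrate the tangent inequality \<open>1 + z \<le> exp z\<close> for
  \<open>z = (s - u) * (q - Y)\<close> against the tilted weight \<open>exp (s * Y - (s - u) * q)\<close>.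
\<close>
lemma ln_mgf_diff_le:
  fixes Y :: "'a \<Rightarrow> real"
  assumes u: "integrable M (\<lambda>\<omega>. exp (u * Y \<omega>))"
    and s: "integrable M (\<lambda>\<omega>. exp (s * Y \<omega>))"
    and Ys: "integrable M (\<lambda>\<omega>. Y \<omega> * exp (s * Y \<omega>))"
    and q: "expectation (\<lambda>\<omega>. Y \<omega> * exp (s * Y \<omega>)) \<le> q * expectation (\<lambda>\<omega>. exp (s * Y \<omega>))"
    and "u \<le> s"
  shows "ln (expectation (\<lambda>\<omega>. exp (s * Y \<omega>))) - ln (expectation (\<lambda>\<omega>. exp (u * Y \<omega>))) \<le> (s - u) * q"
proof -
  let ?m = "\<lambda>s. expectation (\<lambda>\<omega>. exp (s * Y \<omega>))"
  let ?h = "s - u"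
  have pos: "0 < ?m s" "0 < ?m u" using s u by (intro expectation_exp_pos; simp)+
  have "exp (- ?h * q) * ((1 + ?h * q) * exp (s * Y \<omega>) - ?h * (Y \<omega> * exp (s * Y \<omega>))) \<le> exp (u * Y \<omega>)"
    for \<omega>
  proof -
    have "exp (s * Y \<omega> - ?h * q) * (1 + ?h * (q - Y \<omega>)) \<le> exp (s * Y \<omega> - ?h * q) * exp (?h * (q - Y \<omega>))"
      by (intro mult_left_mono) (auto intro: exp_ge_add_one_self)
    also have "\<dots> = exp (u * Y \<omega>)" by (simp add: algebra_simps flip: exp_add)
    also have "exp (s * Y \<omega> - ?h * q) = exp (- ?h * q) * exp (s * Y \<omega>)" by (simp add: algebra_simps flip: exp_add)
    finally have "exp (- ?h * q) * exp (s * Y \<omega>) * (1 + ?h * (q - Y \<omega>)) \<le> exp (u * Y \<omega>)" .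
    moreover have "e * ((1 + ?h * q) * E - ?h * (y * E)) = e * E * (1 + ?h * (q - y))" for e E y :: real
      by (simp add: algebra_simps)
    ultimately show ?thesis by (simp only:)
  qed
  then have "expectation (\<lambda>\<omega>. exp (- ?h * q) * ((1 + ?h * q) * exp (s * Y \<omega>) - ?h * (Y \<omega> * exp (s * Y \<omega>)))) \<le> ?m u"
    using u s Ys by (intro integral_mono) auto
  then have "exp (- ?h * q) * ((1 + ?h * q) * ?m s - ?h * expectation (\<lambda>\<omega>. Y \<omega> * exp (s * Y \<omega>))) \<le> ?m u"
    using s Ys by simp
  moreover have "?m s \<le> (1 + ?h * q) * ?m s - ?h * expectation (\<lambda>\<omega>. Y \<omega> * exp (s * Y \<omega>))"
    using mult_left_mono[OF q, of ?h] \<open>u \<le> s\<close> by (simp add: algebra_simps)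
  ultimately have "exp (- ?h * q) * ?m s \<le> ?m u"
    by (meson exp_ge_zero mult_left_mono order_trans)
  then have "ln (exp (- ?h * q) * ?m s) \<le> ln (?m u)"
    using pos by (intro ln_mono) auto
  then show ?thesis using pos by (simp add: ln_mult left_diff_distrib)
qed

lemma Chernoff_bound_ln_mgf:
  fixes Y :: "'a \<Rightarrow> real"
  assumes Y: "Y \<in> borel_measurable M" and i: "integrable M (\<lambda>\<omega>. exp (s * Y \<omega>))" and "0 \<le> s"
  shows "\<P>(\<omega> in M. t \<le> Y \<omega>) \<le> exp (- (s * t) + ln (expectation (\<lambda>\<omega>. exp (s * Y \<omega>))))"
proof -
  have "\<P>(\<omega> in M. t \<le> Y \<omega>) \<le> \<P>(\<omega> in M. exp (s * t) \<le> exp (s * Y \<omega>))"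
    using Y \<open>0 \<le> s\<close> by (intro finite_measure_mono) (auto intro: mult_left_mono)
  also have "\<dots> \<le> expectation (\<lambda>\<omega>. exp (s * Y \<omega>)) / exp (s * t)"
    using i by (intro integral_Markov_inequality_measure[where A = "space M", simplified]) auto
  also have "\<dots> = exp (- (s * t) + ln (expectation (\<lambda>\<omega>. exp (s * Y \<omega>))))"
    using expectation_exp_pos[OF i] by (simp add: exp_diff)
  finally show ?thesis .
qed

text \<open>
  The identity for \<open>exp (s * x)\<close> together with \<open>Ys \<le> Y + c\<close> yields
  \<open>m' s \<le> (B + K * s * exp (c * s)) * m s\<close> for the moment generating function \<open>m\<close>.
  Integration of this bound for the logarithmic derivative and Markov's inequality give the claim.
  Only the identity for exponentials is assumed, and \<open>R\<close> stands for the remainder already divided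
  by \<open>\<lambda>\<close>; in this form the lemma is stable under the reflection to \<open>-Y\<close>, \<open>-Ys\<close>, \<open>-R\<close>.
\<close>
lemma exponential_tail_bound:
  fixes Y Ys R :: "'a \<Rightarrow> real"
  assumes meas: "Y \<in> borel_measurable M" "Ys \<in> borel_measurable M"
    and Y: "integrable M Y"
    and exp_int: "\<And>s. 0 < s \<Longrightarrow> s < \<alpha> \<Longrightarrow> integrable M (\<lambda>\<omega>. exp (s * Y \<omega>))"
    and R: "\<And>s. 0 < s \<Longrightarrow> s < \<alpha> \<Longrightarrow> integrable M (\<lambda>\<omega>. R \<omega> * exp (s * Y \<omega>)) \<and>
      expectation (\<lambda>\<omega>. R \<omega> * exp (s * Y \<omega>)) \<le> B * expectation (\<lambda>\<omega>. exp (s * Y \<omega>))"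
    and bias: "\<And>s. 0 < s \<Longrightarrow> s < \<alpha> \<Longrightarrow> integrable M (\<lambda>\<omega>. Y \<omega> * exp (s * Y \<omega>)) \<Longrightarrow>
      integrable M (\<lambda>\<omega>. exp (s * Ys \<omega>)) \<Longrightarrow> integrable M (\<lambda>\<omega>. R \<omega> * exp (s * Y \<omega>)) \<Longrightarrow>
      expectation (\<lambda>\<omega>. Y \<omega> * exp (s * Y \<omega>)) =
        a * (s * expectation (\<lambda>\<omega>. exp (s * Ys \<omega>))) + expectation (\<lambda>\<omega>. R \<omega> * exp (s * Y \<omega>))"
    and a: "\<bar>a\<bar> \<le> K" and c: "0 < c" "AE \<omega> in M. Ys \<omega> - Y \<omega> \<le> c" and s: "0 < s" "s < \<alpha>"
  shows "\<P>(\<omega> in M. t \<le> Y \<omega>) \<le> exp (- (s * t) + (B * s + K * (id_exp_integral (c * s) / c\<^sup>2)))"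
proof -
  let ?m = "\<lambda>s. expectation (\<lambda>\<omega>. exp (s * Y \<omega>))"
  define g where "g s = B + K * (s * exp (c * s))" for s
  have exp_int': "integrable M (\<lambda>\<omega>. exp (s * Y \<omega>))" if "0 \<le> s" "s < \<alpha>" for s
    using exp_int[of s] that by (cases "s = 0") auto
  have YexpY: "integrable M (\<lambda>\<omega>. Y \<omega> * exp (s * Y \<omega>))" if "0 < s" "s < \<alpha>" for s
    using that by (intro integrable_mult_exp[OF Y exp_int[of "(s + \<alpha>) / 2"]]) auto
  have key: "expectation (\<lambda>\<omega>. Y \<omega> * exp (s * Y \<omega>)) \<le> g s * ?m s" if s: "0 < s" "s < \<alpha>" for s
  proof -
    have le: "AE \<omega> in M. exp (s * Ys \<omega>) \<le> exp (c * s) * exp (s * Y \<omega>)"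
      using c(2)
    proof eventually_elim
      case (elim \<omega>)
      then have "s * Ys \<omega> \<le> s * (c + Y \<omega>)" using s by (intro mult_left_mono) auto
      then show ?case by (simp add: algebra_simps flip: exp_add)
    qed
    have int: "integrable M (\<lambda>\<omega>. exp (c * s) * exp (s * Y \<omega>))" using exp_int[OF s] by simp
    have intYs: "integrable M (\<lambda>\<omega>. exp (s * Ys \<omega>))"
      by (rule Bochner_Integration.integrable_bound[OF int])
        (use meas le in \<open>auto\<close>)
    have "expectation (\<lambda>\<omega>. exp (s * Ys \<omega>)) \<le> expectation (\<lambda>\<omega>. exp (c * s) * exp (s * Y \<omega>))"
      by (rule integral_mono_AE[OF intYs int le])
    then have *: "s * expectation (\<lambda>\<omega>. exp (s * Ys \<omega>)) \<le> s * exp (c * s) * ?m s"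
      using s by (simp add: mult.assoc)
    have nonneg: "0 \<le> s * expectation (\<lambda>\<omega>. exp (s * Ys \<omega>))"
      using s by (intro mult_nonneg_nonneg integral_nonneg_AE) auto
    \<comment> \<open>The coefficient \<open>a\<close> may be negative; its bound by \<open>K\<close> is preserved since the other factor is not.\<close>
    have "a * (s * expectation (\<lambda>\<omega>. exp (s * Ys \<omega>))) \<le> K * (s * expectation (\<lambda>\<omega>. exp (s * Ys \<omega>)))"
      using a nonneg by (intro mult_right_mono) auto
    also have "\<dots> \<le> K * (s * exp (c * s) * ?m s)"
      using a * by (intro mult_left_mono) auto
    finally have "a * (s * expectation (\<lambda>\<omega>. exp (s * Ys \<omega>))) \<le> K * (s * exp (c * s) * ?m s)" .
    with R[OF s] bias[OF s YexpY[OF s] intYs] show ?thesis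
      by (simp add: g_def algebra_simps)
  qed
  have "ln (?m s) - ln (?m 0) \<le> (B * s + K * (id_exp_integral (c * s) / c\<^sup>2)) - (B * 0 + K * (id_exp_integral (c * 0) / c\<^sup>2))"
  proof (rule telescoping_upper_bound[where g = g])
    fix u v assume "0 \<le> u" "u < v" "v \<le> s"
    with s show "ln (?m v) - ln (?m u) \<le> (v - u) * g v"
      by (intro ln_mgf_diff_le exp_int' YexpY key) auto
  next
    fix v :: real
    have "((\<lambda>v. id_exp_integral (c * v)) has_real_derivative (c * v * exp (c * v) * c)) (at v)"
      by (rule DERIV_chain2[OF DERIV_id_exp_integral]) (auto intro!: derivative_eq_intros)
    then have "((\<lambda>v. B * v + K * (id_exp_integral (c * v) / c\<^sup>2)) has_real_derivative
        (B * 1 + K * (c * v * exp (c * v) * c / c\<^sup>2))) (at v)"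
      by (intro derivative_intros DERIV_cmult DERIV_cdivide)
    then show "((\<lambda>v. B * v + K * (id_exp_integral (c * v) / c\<^sup>2)) has_real_derivative g v) (at v)"
      using c by (simp add: g_def power2_eq_square)
  next
    fix u v :: real assume "0 \<le> u" "u \<le> v"
    then have "u * exp (c * u) \<le> v * exp (c * v)" using c by (intro mult_mono) auto
    then show "g u \<le> g v" using a unfolding g_def by (intro add_left_mono mult_left_mono) auto
  qed (use s in auto)
  then have "ln (?m s) \<le> B * s + K * (id_exp_integral (c * s) / c\<^sup>2)" by (simp add: id_exp_integral_def prob_space)
  then have "exp (- (s * t) + ln (?m s)) \<le> exp (- (s * t) + (B * s + K * (id_exp_integral (c * s) / c\<^sup>2)))" by simp
  then show ?thesis
    using Chernoff_bound_ln_mgf[OF meas(1) exp_int[OF s], of t] s by (meson less_imp_le order_trans)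
qed

end

section \<open>The remainder term\<close>

context prob_space
begin

lemma covariance_eq:
  assumes "integrable M U" "integrable M V" "integrable M (\<lambda>\<omega>. U \<omega> * V \<omega>)"
  shows "covariance M U V = expectation (\<lambda>\<omega>. U \<omega> * V \<omega>) - expectation U * expectation V"
proof -
  have "(\<lambda>\<omega>. (U \<omega> - expectation U) * (V \<omega> - expectation V)) =
      (\<lambda>\<omega>. U \<omega> * V \<omega> - expectation V * U \<omega> - expectation U * V \<omega> + expectation U * expectation V)"
    by (simp add: algebra_simps)
  then show ?thesis
    using assms by (simp add: covariance_def prob_space)
qed

text \<open>
  The real conditional expectation is the difference of those of the positive and the negative part,
  and each nonnegative conditional expectation reproduces every nonnegative measurable function of
  \<open>Y\<close>.  In this way the identity is available before \<open>r (Y)\<close> is known to be integrable.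
\<close>
lemma AE_cond_exp_eq_self:
  fixes Y :: "'a \<Rightarrow> real"
  assumes Y: "Y \<in> borel_measurable M" and r: "r \<in> borel_measurable borel"
  shows "AE \<omega> in M. real_cond_exp M (vimage_algebra (space M) Y borel) (\<lambda>\<omega>. r (Y \<omega>)) \<omega> = r (Y \<omega>)"
proof -
  let ?F = "vimage_algebra (space M) Y borel"
  have F: "Y \<in> borel_measurable ?F" by (rule measurable_vimage_algebra1) auto
  have "subalgebra M ?F"
    using measurable_sets[OF Y] by (auto simp: subalgebra_def sets_vimage_algebra2)
  then interpret finite_measure_subalgebra M ?F by unfold_locales
  have "AE \<omega> in M. ennreal (r (Y \<omega>)) = nn_cond_exp M ?F (\<lambda>\<omega>. ennreal (r (Y \<omega>))) \<omega>"
    "AE \<omega> in M. ennreal (- r (Y \<omega>)) = nn_cond_exp M ?F (\<lambda>\<omega>. ennreal (- r (Y \<omega>))) \<omega>"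
    using F r by (intro nn_cond_exp_F_meas; measurable)+
  then show ?thesis
    unfolding real_cond_exp_def
  proof eventually_elim
    case (elim \<omega>)
    then show ?case by (cases "0 \<le> r (Y \<omega>)") (simp_all flip: elim add: ennreal_neg)
  qed
qed

text \<open>
  Both branches of the definition of \<open>B1\<close> serve this estimate.  If \<open>\<bar>R\<bar>\<close> and the exponential are
  negatively correlated, the expectation of their product is at most the product of their
  expectations.  Otherwise \<open>R\<close>, being a function of \<open>Y\<close>, is its own conditional expectation given
  \<open>Y\<close>, so the essential supremum bounds \<open>\<bar>R\<bar>\<close> itself.
\<close>
lemma expectation_mult_exp_le_B1:
  fixes Y R :: "'a \<Rightarrow> real" and r :: "real \<Rightarrow> real"
  assumes Y: "Y \<in> borel_measurable M" and r: "r \<in> borel_measurable borel"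
    and R_def: "R = (\<lambda>\<omega>. r (Y \<omega>))"
    and l: "0 < l" and B: "0 \<le> B" "B1 M Y R l S = ennreal B"
    and s: "s \<in> S" "integrable M (\<lambda>\<omega>. exp (s * Y \<omega>))"
  shows "integrable M (\<lambda>\<omega>. R \<omega> * exp (s * Y \<omega>))"
    and "expectation (\<lambda>\<omega>. \<bar>R \<omega> * exp (s * Y \<omega>)\<bar>) \<le> l * B * expectation (\<lambda>\<omega>. exp (s * Y \<omega>))"
proof -
  have [measurable]: "R \<in> borel_measurable M" "Y \<in> borel_measurable M"
    using Y r by (auto simp: R_def)
  have div: "x = ennreal (l * B)" if "x / ennreal l = ennreal B" for x
  proof -
    have "x = x / ennreal l * ennreal l"
      using l by (simp add: ennreal_divide_times ennreal_divide_self)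
    then show ?thesis using that l B by (simp add: ennreal_mult mult.commute)
  qed
  have "integrable M (\<lambda>\<omega>. \<bar>R \<omega> * exp (s * Y \<omega>)\<bar>) \<and>
    expectation (\<lambda>\<omega>. \<bar>R \<omega> * exp (s * Y \<omega>)\<bar>) \<le> l * B * expectation (\<lambda>\<omega>. exp (s * Y \<omega>))"
  proof (cases "\<forall>s\<in>S. negatively_correlated M (\<lambda>\<omega>. \<bar>R \<omega>\<bar>) (\<lambda>\<omega>. exp (s * Y \<omega>))")
    case True
    with s have nc: "negatively_correlated M (\<lambda>\<omega>. \<bar>R \<omega>\<bar>) (\<lambda>\<omega>. exp (s * Y \<omega>))" by blast
    then have int: "integrable M (\<lambda>\<omega>. \<bar>R \<omega>\<bar>)" "integrable M (\<lambda>\<omega>. \<bar>R \<omega>\<bar> * exp (s * Y \<omega>))"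
      by (auto simp: negatively_correlated_def)
    have "(\<integral>\<^sup>+\<omega>. ennreal \<bar>R \<omega>\<bar> \<partial>M) = ennreal (l * B)"
      using B(2) True by (intro div) (simp add: B1_def)
    then have "ennreal (expectation (\<lambda>\<omega>. \<bar>R \<omega>\<bar>)) = ennreal (l * B)"
      using nn_integral_eq_integral[OF int(1)] by simp
    then have "expectation (\<lambda>\<omega>. \<bar>R \<omega>\<bar>) = l * B"
      using l B by (subst (asm) ennreal_inj) auto
    moreover have "covariance M (\<lambda>\<omega>. \<bar>R \<omega>\<bar>) (\<lambda>\<omega>. exp (s * Y \<omega>)) \<le> 0"
      using nc by (simp add: negatively_correlated_def)
    ultimately show ?thesis
      using int s by (simp add: covariance_eq abs_mult)
  next
    case False
    have "esssup M (\<lambda>\<omega>. ennreal \<bar>real_cond_exp M (vimage_algebra (space M) Y borel) R \<omega>\<bar>) = ennreal (l * B)"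
      using B(2) unfolding B1_def if_not_P[OF False] by (rule div)
    then have "AE \<omega> in M. ennreal \<bar>real_cond_exp M (vimage_algebra (space M) Y borel) R \<omega>\<bar> \<le> ennreal (l * B)"
      using esssup_AE by metis
    with AE_cond_exp_eq_self[OF Y r] have le: "AE \<omega> in M. \<bar>R \<omega> * exp (s * Y \<omega>)\<bar> \<le> l * B * exp (s * Y \<omega>)"
      unfolding R_def
    proof eventually_elim
      case (elim \<omega>)
      then have "\<bar>r (Y \<omega>)\<bar> \<le> l * B" using l B by simp
      then show ?case by (simp add: abs_mult mult_right_mono)
    qed
    have int: "integrable M (\<lambda>\<omega>. l * B * exp (s * Y \<omega>))" using s by simp
    have int': "integrable M (\<lambda>\<omega>. \<bar>R \<omega> * exp (s * Y \<omega>)\<bar>)"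
    proof (rule Bochner_Integration.integrable_bound[OF int])
      show "AE \<omega> in M. norm \<bar>R \<omega> * exp (s * Y \<omega>)\<bar> \<le> norm (l * B * exp (s * Y \<omega>))"
        using le l B by (simp add: abs_mult)
    qed measurable
    with integral_mono_AE[OF int' int le] show ?thesis by simp
  qed
  then show "integrable M (\<lambda>\<omega>. R \<omega> * exp (s * Y \<omega>))"
    and "expectation (\<lambda>\<omega>. \<bar>R \<omega> * exp (s * Y \<omega>)\<bar>) \<le> l * B * expectation (\<lambda>\<omega>. exp (s * Y \<omega>))"
    by (auto intro: integrable_abs_cancel)
qed

end

lemma integrable_exp_iff_mgf:
  assumes "Y \<in> borel_measurable M"
  shows "integrable M (\<lambda>\<omega>. exp (s * Y \<omega>)) \<longleftrightarrow> mgf M Y s < \<infinity>"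
  using assms by (simp add: mgf_def integrable_iff_bounded)

section \<open>Exponential bounds for both tails\<close>

locale approx_zero_bias_pair = prob_space M for M :: "'a measure" +
  fixes Y Ys R :: "'a \<Rightarrow> real" and r :: "real \<Rightarrow> real" and \<sigma> l :: real
  assumes Y_meas: "Y \<in> borel_measurable M" and Ys_meas: "Ys \<in> borel_measurable M"
    and r_meas: "r \<in> borel_measurable borel" and R_eq: "R = (\<lambda>\<omega>. r (Y \<omega>))"
    and Y_int: "integrable M Y" and l_pos: "0 < l"
    and zero_bias: "approx_zero_bias M Y R \<sigma> l Ys"
begin

abbreviation "K \<equiv> \<sigma>\<^sup>2 + B2 M Y R l"

lemma coefficient_le: "\<bar>\<sigma>\<^sup>2 - expectation (\<lambda>\<omega>. Y \<omega> * R \<omega>) / l\<bar> \<le> K"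
  unfolding B2_def using l_pos abs_triangle_ineq4[of "\<sigma>\<^sup>2" "expectation (\<lambda>\<omega>. Y \<omega> * R \<omega>) / l"] by simp

lemma expectation_mult_exp_div_le:
  assumes "0 \<le> B" "B1 M Y R l S = ennreal B" "s \<in> S" "integrable M (\<lambda>\<omega>. exp (s * Y \<omega>))"
  shows "integrable M (\<lambda>\<omega>. R \<omega> / l * exp (s * Y \<omega>))"
    and "\<bar>expectation (\<lambda>\<omega>. R \<omega> / l * exp (s * Y \<omega>))\<bar> \<le> B * expectation (\<lambda>\<omega>. exp (s * Y \<omega>))"
proof -
  note B1 = expectation_mult_exp_le_B1[OF Y_meas r_meas R_eq l_pos assms]
  have *: "(\<lambda>\<omega>. R \<omega> / l * exp (s * Y \<omega>)) = (\<lambda>\<omega>. R \<omega> * exp (s * Y \<omega>) / l)" by simp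
  show "integrable M (\<lambda>\<omega>. R \<omega> / l * exp (s * Y \<omega>))" unfolding * using B1(1) by simp
  have "\<bar>expectation (\<lambda>\<omega>. R \<omega> * exp (s * Y \<omega>))\<bar> \<le> l * B * expectation (\<lambda>\<omega>. exp (s * Y \<omega>))"
    by (rule order_trans[OF integral_abs_bound B1(2)])
  then show "\<bar>expectation (\<lambda>\<omega>. R \<omega> / l * exp (s * Y \<omega>))\<bar> \<le> B * expectation (\<lambda>\<omega>. exp (s * Y \<omega>))"
    unfolding * using l_pos by (simp add: pos_divide_le_eq mult_ac)
qed

lemma expectation_mult_exp_eq:
  assumes "integrable M (\<lambda>\<omega>. Y \<omega> * exp (s * Y \<omega>))"
    and "integrable M (\<lambda>\<omega>. exp (s * Ys \<omega>))"
    and "integrable M (\<lambda>\<omega>. R \<omega> / l * exp (s * Y \<omega>))"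
  shows "expectation (\<lambda>\<omega>. Y \<omega> * exp (s * Y \<omega>)) =
    (\<sigma>\<^sup>2 - expectation (\<lambda>\<omega>. Y \<omega> * R \<omega>) / l) * (s * expectation (\<lambda>\<omega>. exp (s * Ys \<omega>)))
      + expectation (\<lambda>\<omega>. R \<omega> / l * exp (s * Y \<omega>))"
proof -
  have *: "(\<lambda>\<omega>. R \<omega> / l * exp (s * Y \<omega>)) = (\<lambda>\<omega>. R \<omega> * exp (s * Y \<omega>) / l)" by simp
  have "integrable M (\<lambda>\<omega>. l * (R \<omega> / l * exp (s * Y \<omega>)))"
    using assms(3) by (rule integrable_mult_right)
  then have "integrable M (\<lambda>\<omega>. R \<omega> * exp (s * Y \<omega>))" using l_pos by simp
  from approx_zero_bias_exp[OF zero_bias assms(1,2) this] show ?thesis unfolding * by simp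
qed

lemma right_tail_exponential_bound:
  assumes c: "0 < c" "AE \<omega> in M. Ys \<omega> - Y \<omega> \<le> c"
    and mgf: "\<And>s. 0 < s \<Longrightarrow> s < \<alpha> \<Longrightarrow> mgf M Y s < \<infinity>"
    and B: "0 \<le> B" "B1 M Y R l {0<..<\<alpha>} = ennreal B" and s: "0 < s" "s < \<alpha>"
  shows "\<P>(\<omega> in M. t \<le> Y \<omega>) \<le> exp (- (s * t) + (B * s + K * (id_exp_integral (c * s) / c\<^sup>2)))"
proof (rule exponential_tail_bound[where Ys = Ys and R = "\<lambda>\<omega>. R \<omega> / l" and \<alpha> = \<alpha>])
  fix s assume s: "0 < s" "s < \<alpha>"
  then show int: "integrable M (\<lambda>\<omega>. exp (s * Y \<omega>))"
    using mgf by (simp add: integrable_exp_iff_mgf[OF Y_meas])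
  have "s \<in> {0<..<\<alpha>}" using s by simp
  from expectation_mult_exp_div_le[OF B this int]
  show "integrable M (\<lambda>\<omega>. R \<omega> / l * exp (s * Y \<omega>)) \<and>
      expectation (\<lambda>\<omega>. R \<omega> / l * exp (s * Y \<omega>)) \<le> B * expectation (\<lambda>\<omega>. exp (s * Y \<omega>))"
    by (intro conjI) (assumption, rule order_trans[OF abs_ge_self])
next
  fix s
  assume "integrable M (\<lambda>\<omega>. Y \<omega> * exp (s * Y \<omega>))"
    and "integrable M (\<lambda>\<omega>. exp (s * Ys \<omega>))"
    and "integrable M (\<lambda>\<omega>. R \<omega> / l * exp (s * Y \<omega>))"
  then show "expectation (\<lambda>\<omega>. Y \<omega> * exp (s * Y \<omega>)) =
      (\<sigma>\<^sup>2 - expectation (\<lambda>\<omega>. Y \<omega> * R \<omega>) / l) * (s * expectation (\<lambda>\<omega>. exp (s * Ys \<omega>)))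
        + expectation (\<lambda>\<omega>. R \<omega> / l * exp (s * Y \<omega>))"
    by (rule expectation_mult_exp_eq)
qed (fact Y_meas Ys_meas Y_int c s coefficient_le)+

text \<open>
  The reflection is applied to the identity for \<open>exp (- s * x)\<close> and not to the zero bias property
  itself: where \<open>f\<close> is not differentiable, \<open>deriv f\<close> has an unspecified value, and this value is not
  compatible with replacing \<open>f x\<close> by \<open>f (- x)\<close>.
\<close>
lemma left_tail_exponential_bound:
  assumes c: "0 < c" "AE \<omega> in M. Y \<omega> - Ys \<omega> \<le> c"
    and mgf: "\<And>s. 0 < s \<Longrightarrow> s < \<alpha> \<Longrightarrow> mgf M Y (- s) < \<infinity>"
    and B: "0 \<le> B" "B1 M Y R l {-\<alpha><..<0} = ennreal B" and s: "0 < s" "s < \<alpha>"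
  shows "\<P>(\<omega> in M. Y \<omega> \<le> - t) \<le> exp (- (s * t) + (B * s + K * (id_exp_integral (c * s) / c\<^sup>2)))"
proof -
  have "\<P>(\<omega> in M. t \<le> - Y \<omega>) \<le> exp (- (s * t) + (B * s + K * (id_exp_integral (c * s) / c\<^sup>2)))"
  proof (rule exponential_tail_bound[where Ys = "\<lambda>\<omega>. - Ys \<omega>" and R = "\<lambda>\<omega>. - (R \<omega> / l)" and \<alpha> = \<alpha>])
    fix s assume s: "0 < s" "s < \<alpha>"
    then have int: "integrable M (\<lambda>\<omega>. exp (- s * Y \<omega>))"
      using mgf by (simp add: integrable_exp_iff_mgf[OF Y_meas, of "- s", simplified])
    then show "integrable M (\<lambda>\<omega>. exp (s * - Y \<omega>))" by simp
    have *: "(\<lambda>\<omega>. - (R \<omega> / l) * exp (s * - Y \<omega>)) = (\<lambda>\<omega>. - (R \<omega> / l * exp (- s * Y \<omega>)))"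
      "(\<lambda>\<omega>. exp (s * - Y \<omega>)) = (\<lambda>\<omega>. exp (- s * Y \<omega>))"
      by simp_all
    have "- s \<in> {-\<alpha><..<0}" using s by simp
    note R_le = expectation_mult_exp_div_le[OF B this int]
    show "integrable M (\<lambda>\<omega>. - (R \<omega> / l) * exp (s * - Y \<omega>)) \<and>
        expectation (\<lambda>\<omega>. - (R \<omega> / l) * exp (s * - Y \<omega>)) \<le> B * expectation (\<lambda>\<omega>. exp (s * - Y \<omega>))"
      unfolding * integral_minus using R_le(2)
      by (intro conjI Bochner_Integration.integrable_minus R_le(1)) (simp only: abs_le_iff)
    assume "integrable M (\<lambda>\<omega>. - Y \<omega> * exp (s * - Y \<omega>))"
      and "integrable M (\<lambda>\<omega>. exp (s * - Ys \<omega>))"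
      and "integrable M (\<lambda>\<omega>. - (R \<omega> / l) * exp (s * - Y \<omega>))"
    then show "expectation (\<lambda>\<omega>. - Y \<omega> * exp (s * - Y \<omega>)) =
        (\<sigma>\<^sup>2 - expectation (\<lambda>\<omega>. Y \<omega> * R \<omega>) / l) * (s * expectation (\<lambda>\<omega>. exp (s * - Ys \<omega>)))
          + expectation (\<lambda>\<omega>. - (R \<omega> / l) * exp (s * - Y \<omega>))"
      using expectation_mult_exp_eq[of "- s"] by simp
  next
    show "AE \<omega> in M. - Ys \<omega> - - Y \<omega> \<le> c" using c(2) by simp
  qed (use Y_meas Ys_meas Y_int in \<open>simp_all add: coefficient_le c(1) s\<close>)
  then show ?thesis by (simp add: le_minus_iff)
qed

lemma right_tail_exponential_bound_if_mgf_at_endpoint: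
  assumes "0 < c" "AE \<omega> in M. Ys \<omega> - Y \<omega> \<le> c"
    and "mgf M Y \<alpha> < \<infinity>" "0 \<le> B" "B1 M Y R l {0<..<\<alpha>} = ennreal B" "0 < s" "s < \<alpha>"
  shows "\<P>(\<omega> in M. t \<le> Y \<omega>) \<le> exp (- (s * (t - B)) + K * (id_exp_integral (c * s) / c\<^sup>2))"
proof -
  have "mgf M Y v < \<infinity>" if "0 < v" "v < \<alpha>" for v
    using integrable_exp_mult_mono[OF Y_meas, of \<alpha> v] that assms(3)
    by (simp add: integrable_exp_iff_mgf[OF Y_meas])
  from right_tail_exponential_bound[OF assms(1,2) this assms(4-7), of t]
  show ?thesis by (simp add: algebra_simps)
qed

lemma left_tail_exponential_bound_if_mgf_at_endpoint:
  assumes "0 < c" "AE \<omega> in M. Y \<omega> - Ys \<omega> \<le> c"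
    and "mgf M Y (- \<alpha>) < \<infinity>" "0 \<le> B" "B1 M Y R l {-\<alpha><..<0} = ennreal B" "0 < s" "s < \<alpha>"
  shows "\<P>(\<omega> in M. Y \<omega> \<le> - t) \<le> exp (- (s * (t - B)) + K * (id_exp_integral (c * s) / c\<^sup>2))"
proof -
  have "mgf M Y (- v) < \<infinity>" if "0 < v" "v < \<alpha>" for v
  proof -
    have "integrable M (\<lambda>\<omega>. exp (- \<alpha> * Y \<omega>))"
      using assms(3) by (rule integrable_exp_iff_mgf[OF Y_meas, THEN iffD2])
    then have "integrable M (\<lambda>\<omega>. exp (- v * Y \<omega>))"
      using integrable_exp_mult_mono[of "\<lambda>\<omega>. - Y \<omega>" \<alpha> v] that Y_meas by simp
    then show ?thesis by (rule integrable_exp_iff_mgf[OF Y_meas, THEN iffD1])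
  qed
  from left_tail_exponential_bound[OF assms(1,2) this assms(4-7), of t]
  show ?thesis by (simp add: algebra_simps)
qed

end

section \<open>Optimising the exponent\<close>

lemma bernstein_bound_from_exponential_bounds:
  fixes p :: real
  assumes "0 < c" "0 < K" "0 < t"
    and p: "\<And>s. 0 < s \<Longrightarrow> s < 1 / c \<Longrightarrow> p \<le> exp (- (s * t) + (B * s + K * (id_exp_integral (c * s) / c\<^sup>2)))"
  shows "p \<le> exp (- (t * (t - 2 * B) / (2 * (K + c * t))))"
proof -
  define D where "D = K + c * t"
  \<comment> \<open>Then \<open>1 - c * s = K / D\<close>, and the majorant of the integral term is exactly \<open>s * t / 2\<close>.\<close>
  define s where "s = t / D"
  have D: "0 < D" using assms by (simp add: D_def add_pos_pos)
  have t: "t = s * D" and cs: "1 - c * s = K / D"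
    using D by (simp_all add: s_def field_simps) (simp add: D_def)
  have "0 < K / D" using assms D by simp
  with cs have "c * s < 1" by linarith
  moreover have "0 < s" using assms D by (simp add: s_def)
  ultimately have s: "0 < s" "c * s < 1" by simp_all
  have "id_exp_integral (c * s) / c\<^sup>2 \<le> (c * s)\<^sup>2 / (2 * (1 - c * s)) / c\<^sup>2"
    using assms s by (intro divide_right_mono id_exp_integral_le_quadratic) auto
  also have "\<dots> = s\<^sup>2 / (2 * (K / D))"
    using assms by (simp add: cs power_mult_distrib)
  finally have "K * (id_exp_integral (c * s) / c\<^sup>2) \<le> K * (s\<^sup>2 / (2 * (K / D)))"
    using assms by (intro mult_left_mono) auto
  also have "\<dots> = s * t / 2" using assms D by (simp add: t power2_eq_square)
  finally have integral_term: "K * (id_exp_integral (c * s) / c\<^sup>2) \<le> s * t / 2" .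
  have exponent: "t * (t - 2 * B) / (2 * D) = s * t / 2 - B * s"
    using D by (simp add: s_def field_simps)
  have "- (s * t) + (B * s + K * (id_exp_integral (c * s) / c\<^sup>2)) \<le> - (t * (t - 2 * B) / (2 * D))"
    unfolding exponent using integral_term by linarith
  moreover have "p \<le> exp (- (s * t) + (B * s + K * (id_exp_integral (c * s) / c\<^sup>2)))"
    using assms s by (intro p) (auto simp: field_simps)
  ultimately show ?thesis unfolding D_def by (meson exp_le_cancel_iff order_trans)
qed

text \<open>
  With \<open>D\<close> the denominator of the exponent and \<open>s = 2 * t / D\<close>, the Pade majorant of the integral
  term is exactly \<open>s * t / 2\<close>.
\<close>
lemma bernstein_pade_bound_from_exponential_bounds:
  fixes p :: real
  assumes "0 < c" "0 < K" "0 < t"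
    and p: "\<And>s. 0 < s \<Longrightarrow> s < 2 / c \<Longrightarrow> p \<le> exp (- (s * t) + (B * s + K * (id_exp_integral (c * s) / c\<^sup>2)))"
  shows "p \<le> exp (- (t * (t - 2 * B) / (10 * K / 3 + c * t)))"
proof -
  define D where "D = 10 * K / 3 + c * t"
  define s where "s = 2 * t / D"
  have D: "0 < D" using assms by (simp add: D_def add_pos_pos)
  have t: "t = s * D / 2" using D by (simp add: s_def)
  have "2 - c * s = (2 * D - 2 * c * t) / D" using D by (simp add: s_def diff_divide_distrib)
  also have "2 * D - 2 * c * t = 20 * K / 3" by (simp add: D_def)
  finally have cs: "2 - c * s = 20 * K / (3 * D)" by simp
  have "0 < 20 * K / (3 * D)" using assms D by simp
  with cs have "c * s < 2" by linarith
  moreover have "0 < s" using assms D by (simp add: s_def)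
  ultimately have s: "0 < s" "c * s < 2" by simp_all
  have "id_exp_integral (c * s) / c\<^sup>2 \<le> 5 / 3 * ((c * s)\<^sup>2 / (2 - c * s)) / c\<^sup>2"
    using assms s by (intro divide_right_mono id_exp_integral_le_quadratic_pade) auto
  also have "\<dots> = 5 / 3 * (s\<^sup>2 / (20 * K / (3 * D)))"
    using assms by (simp add: cs power_mult_distrib)
  finally have "K * (id_exp_integral (c * s) / c\<^sup>2) \<le> K * (5 / 3 * (s\<^sup>2 / (20 * K / (3 * D))))"
    using assms by (intro mult_left_mono) auto
  also have "\<dots> = s * t / 2" using assms D by (simp add: t power2_eq_square)
  finally have integral_term: "K * (id_exp_integral (c * s) / c\<^sup>2) \<le> s * t / 2" .
  have exponent: "t * (t - 2 * B) / D = s * t / 2 - B * s"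
    using D by (simp add: s_def field_simps)
  have "- (s * t) + (B * s + K * (id_exp_integral (c * s) / c\<^sup>2)) \<le> - (t * (t - 2 * B) / D)"
    unfolding exponent using integral_term by linarith
  moreover have "p \<le> exp (- (s * t) + (B * s + K * (id_exp_integral (c * s) / c\<^sup>2)))"
    using assms s by (intro p) (auto simp: field_simps)
  ultimately show ?thesis unfolding D_def by (meson exp_le_cancel_iff order_trans)
qed

lemma half_le_diff_ln:
  fixes L :: real
  assumes "0 < L"
  shows "L / 2 < L - ln L"
  using ln_le_minus_one[of "L / 2"] assms ln_2_less_1 by (simp add: ln_div)

lemma log_bound_le_log_bound_weak:
  assumes "0 < c" "1 < x"
  shows "log_bound c K x \<le> log_bound_weak c K x"
proof -
  have "x / c * (ln x / 2 - K / c) \<le> x / c * (ln x - ln (ln x) - K / c)"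
    using assms half_le_diff_ln[of "ln x"] by (intro mult_left_mono) auto
  also have "x / c * (ln x / 2 - K / c) = x / (2 * c) * (ln x - 2 * K / c)"
    using assms by (simp add: field_simps)
  finally show ?thesis by (simp add: log_bound_def log_bound_weak_def)
qed

text \<open>
  At \<open>\<alpha> = log_alpha c x\<close> one has \<open>exp (c * \<alpha>) = x / ln x\<close>, from which
  \<open>id_exp_integral (c * \<alpha>) \<le> x\<close> follows as soon as \<open>ln x \<ge> 1 / 2\<close>.  The exponential bounds are available only to the left of \<open>\<alpha>\<close>;
  continuity of the bound in \<open>s\<close> extends them to \<open>\<alpha>\<close>.
\<close>
lemma log_bound_from_exponential_bounds:
  fixes p :: real
  assumes "0 < c" "0 < K" "exp (1 / 2) \<le> x"
    and p: "\<And>s. 0 < s \<Longrightarrow> s < log_alpha c x \<Longrightarrow> p \<le> exp (- (s * x) + K * (id_exp_integral (c * s) / c\<^sup>2))"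
  shows "p \<le> log_bound c K x"
proof -
  define L where "L = ln x"
  define \<alpha> where "\<alpha> = log_alpha c x"
  have "0 < x" using assms(3) less_le_trans[OF exp_gt_zero] by blast
  then have x: "x = exp L" and L: "1 / 2 \<le> L"
    using assms(3) ln_ge_iff[of x "1 / 2"] by (simp_all add: L_def)
  have c\<alpha>: "c * \<alpha> = L - ln L" using assms by (simp add: \<alpha>_def log_alpha_def L_def)
  have "0 < c * \<alpha>" using half_le_diff_ln[of L] L unfolding c\<alpha> by linarith
  then have \<alpha>: "0 < \<alpha>" using assms by (simp add: zero_less_mult_iff)
  have "p \<le> exp (- (\<alpha> * x) + K * (id_exp_integral (c * \<alpha>) / c\<^sup>2))"
  proof (rule tendsto_lowerbound)
    show "((\<lambda>s. exp (- (s * x) + K * (id_exp_integral (c * s) / c\<^sup>2))) \<longlongrightarrow> exp (- (\<alpha> * x) + K * (id_exp_integral (c * \<alpha>) / c\<^sup>2))) (at_left \<alpha>)"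
      unfolding id_exp_integral_def using assms by (intro tendsto_intros) auto
    show "\<forall>\<^sub>F s in at_left \<alpha>. p \<le> exp (- (s * x) + K * (id_exp_integral (c * s) / c\<^sup>2))"
      using eventually_at_left_real[OF \<alpha>] by eventually_elim (use p in \<open>auto simp: \<alpha>_def\<close>)
  qed simp
  also have "\<dots> \<le> log_bound c K x"
  proof -
    have "L * exp (- L) \<le> 1 + ln L" by (rule x_exp_minus_le_one_plus_ln[OF L])
    then have "L * exp (- L) * (exp L / L) \<le> (1 + ln L) * (exp L / L)"
      using L by (intro mult_right_mono) auto
    then have "1 \<le> (1 + ln L) * (exp L / L)" using L by (simp add: exp_minus)
    moreover have "id_exp_integral (c * \<alpha>) = (L - ln L - 1) * (exp L / L) + 1"
      using L by (simp add: id_exp_integral_def c\<alpha> exp_diff)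
    moreover have "\<dots> = exp L - (1 + ln L) * (exp L / L) + 1" using L by (simp add: field_simps)
    ultimately have "id_exp_integral (c * \<alpha>) \<le> x" by (simp add: x)
    then have integral_term: "K * (id_exp_integral (c * \<alpha>) / c\<^sup>2) \<le> K * (x / c\<^sup>2)"
      using assms by (intro mult_left_mono divide_right_mono) auto
    have exponent: "- (x / c) * (L - ln L - K / c) = - (\<alpha> * x) + K * (x / c\<^sup>2)"
      unfolding c\<alpha>[symmetric] using assms(1) by (simp add: field_simps power2_eq_square)
    show ?thesis
      unfolding log_bound_def L_def[symmetric] exponent using integral_term by simp
  qed
  finally show ?thesis .
qed

text \<open>
  For \<open>x > 1\<close> the value \<open>s = ln x / (2 * c)\<close>, which lies below \<open>log_alpha c x\<close>, gives the bound
  directly.  A detour over \<open>log_bound\<close> is impossible for \<open>x\<close> close to \<open>1\<close>, where \<open>log_bound\<close> tends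
  to \<open>0\<close>.  For \<open>x \<le> 1\<close> the bound is at least \<open>1\<close>.
\<close>
lemma log_bound_weak_from_exponential_bounds:
  fixes p :: real
  assumes "0 < c" "0 < K" "0 < x" "p \<le> 1"
    and p: "\<And>s. 1 < x \<Longrightarrow> 0 < s \<Longrightarrow> s < log_alpha c x \<Longrightarrow> p \<le> exp (- (s * x) + K * (id_exp_integral (c * s) / c\<^sup>2))"
  shows "p \<le> log_bound_weak c K x"
proof (cases "1 < x")
  case False
  then have "ln x \<le> 0" using assms by simp
  moreover have "0 \<le> 2 * K / c" using assms by simp
  ultimately have "ln x - 2 * K / c \<le> 0" by linarith
  then have "0 \<le> - (x / (2 * c)) * (ln x - 2 * K / c)"
    using assms by (intro mult_nonpos_nonpos) auto
  then have "1 \<le> log_bound_weak c K x" unfolding log_bound_weak_def by simp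
  with assms show ?thesis by simp
next
  case True
  define L where "L = ln x"
  have x: "x = exp L" and L: "0 < L" using True by (auto simp: L_def)
  define s where "s = L / (2 * c)"
  have cs: "c * s = L / 2" using assms by (simp add: s_def)
  have "s < log_alpha c x" "0 < s"
    using assms L half_le_diff_ln[OF L] by (auto simp: s_def log_alpha_def L_def[symmetric] field_simps)
  then have "p \<le> exp (- (s * x) + K * (id_exp_integral (c * s) / c\<^sup>2))" using True by (intro p)
  also have "\<dots> \<le> log_bound_weak c K x"
  proof -
    have "1 \<le> exp (L / 2)" using L by simp
    then have "(L / 2 - 1) * exp (L / 2) + 1 \<le> L / 2 * exp (L / 2)" by (simp add: algebra_simps)
    also have "\<dots> \<le> exp (L / 2) * exp (L / 2)"
      using exp_ge_add_one_self[of "L / 2"] by (intro mult_right_mono) (linarith, simp)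
    also have "\<dots> = x" by (simp add: x algebra_simps flip: exp_add)
    finally have integral_term: "K * (id_exp_integral (c * s) / c\<^sup>2) \<le> K * (x / c\<^sup>2)"
      using assms by (intro mult_left_mono divide_right_mono) (auto simp: id_exp_integral_def cs)
    have exponent: "- (x / (2 * c)) * (L - 2 * K / c) = - (s * x) + K * (x / c\<^sup>2)"
      using assms(1) by (simp add: s_def field_simps power2_eq_square)
    show ?thesis
      unfolding log_bound_weak_def L_def[symmetric] exponent using integral_term by simp
  qed
  finally show ?thesis .
qed

theorem theorem1p2:
  fixes M :: "'a measure" and Y Ys R :: "'a \<Rightarrow> real" and r :: "real \<Rightarrow> real" and \<sigma> l :: real
  assumes "prob_space M"
    and "Y \<in> borel_measurable M" and "Ys \<in> borel_measurable M"
    and "r \<in> borel_measurable borel" and "R = (\<lambda>\<omega>. r (Y \<omega>))"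
    and "integrable M Y" and "integrable M (\<lambda>\<omega>. (Y \<omega>)\<^sup>2)"
    and "prob_space.expectation M Y = 0"
    and "prob_space.variance M Y = \<sigma>\<^sup>2" and "\<sigma>\<^sup>2 > 0"
    and "0 < l" and "l < 1"
    and "approx_zero_bias M Y R \<sigma> l Ys"
    and B2_finite: "integrable M (\<lambda>\<omega>. Y \<omega> * R \<omega>)"
  shows
    \<comment> \<open>(a), first bound, right tail and left tail\<close>
    "(\<forall>c \<alpha> B. 0 < c \<and> \<alpha> = 1 / c \<and> (AE \<omega> in M. Ys \<omega> - Y \<omega> \<le> c) \<and>
        (\<forall>s\<in>{0..<\<alpha>}. mgf M Y s < \<infinity>) \<and> 0 \<le> B \<and> B1 M Y R l {0<..<\<alpha>} = ennreal B \<longrightarrow>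
        (\<forall>t>0. \<P>(\<omega> in M. Y \<omega> \<ge> t)
                 \<le> exp (- (t * (t - 2 * B) / (2 * (\<sigma>\<^sup>2 + B2 M Y R l + c * t)))))) \<and>
     (\<forall>c \<alpha> B. 0 < c \<and> \<alpha> = 1 / c \<and> (AE \<omega> in M. Y \<omega> - Ys \<omega> \<le> c) \<and>
        (\<forall>s\<in>{-\<alpha><..0}. mgf M Y s < \<infinity>) \<and> 0 \<le> B \<and> B1 M Y R l {-\<alpha><..<0} = ennreal B \<longrightarrow>
        (\<forall>t>0. \<P>(\<omega> in M. Y \<omega> \<le> - t)
                 \<le> exp (- (t * (t - 2 * B) / (2 * (\<sigma>\<^sup>2 + B2 M Y R l + c * t)))))) \<and>
     \<comment> \<open>(a), second bound, right tail and left tail\<close>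
     (\<forall>c \<alpha> B. 0 < c \<and> \<alpha> = 2 / c \<and> (AE \<omega> in M. \<bar>Ys \<omega> - Y \<omega>\<bar> \<le> c) \<and>
        (\<forall>s\<in>{0..<\<alpha>}. mgf M Y s < \<infinity>) \<and> 0 \<le> B \<and> B1 M Y R l {0<..<\<alpha>} = ennreal B \<longrightarrow>
        (\<forall>t>0. \<P>(\<omega> in M. Y \<omega> \<ge> t)
                 \<le> exp (- (t * (t - 2 * B) / (10 * (\<sigma>\<^sup>2 + B2 M Y R l) / 3 + c * t))))) \<and>
     (\<forall>c \<alpha> B. 0 < c \<and> \<alpha> = 2 / c \<and> (AE \<omega> in M. Y \<omega> - Ys \<omega> \<le> c) \<and>
        (\<forall>s\<in>{-\<alpha><..0}. mgf M Y s < \<infinity>) \<and> 0 \<le> B \<and> B1 M Y R l {-\<alpha><..<0} = ennreal B \<longrightarrow>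
        (\<forall>t>0. \<P>(\<omega> in M. Y \<omega> \<le> - t)
                 \<le> exp (- (t * (t - 2 * B) / (10 * (\<sigma>\<^sup>2 + B2 M Y R l) / 3 + c * t))))) \<and>
     \<comment> \<open>(b), right tail and left tail\<close>
     (\<forall>c \<alpha> B t. 0 < c \<and> (AE \<omega> in M. Ys \<omega> - Y \<omega> \<le> c) \<and>
        0 \<le> B \<and> B1 M Y R l {0<..<\<alpha>} = ennreal B \<and> B < t \<and> \<alpha> = log_alpha c (t - B) \<and>
        mgf M Y \<alpha> < \<infinity> \<longrightarrow>
        (exp (1 / 2) \<le> t - B \<longrightarrow>
           \<P>(\<omega> in M. Y \<omega> \<ge> t) \<le> log_bound c (\<sigma>\<^sup>2 + B2 M Y R l) (t - B)) \<and>
        (1 < t - B \<longrightarrow>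
           log_bound c (\<sigma>\<^sup>2 + B2 M Y R l) (t - B) \<le> log_bound_weak c (\<sigma>\<^sup>2 + B2 M Y R l) (t - B)) \<and>
        \<P>(\<omega> in M. Y \<omega> \<ge> t) \<le> log_bound_weak c (\<sigma>\<^sup>2 + B2 M Y R l) (t - B)) \<and>
     (\<forall>c \<alpha> B t. 0 < c \<and> (AE \<omega> in M. Y \<omega> - Ys \<omega> \<le> c) \<and>
        0 \<le> B \<and> B1 M Y R l {-\<alpha><..<0} = ennreal B \<and> B < t \<and> \<alpha> = log_alpha c (t - B) \<and>
        mgf M Y (- \<alpha>) < \<infinity> \<longrightarrow>
        (exp (1 / 2) \<le> t - B \<longrightarrow>
           \<P>(\<omega> in M. Y \<omega> \<le> - t) \<le> log_bound c (\<sigma>\<^sup>2 + B2 M Y R l) (t - B)) \<and>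
        (1 < t - B \<longrightarrow>
           log_bound c (\<sigma>\<^sup>2 + B2 M Y R l) (t - B) \<le> log_bound_weak c (\<sigma>\<^sup>2 + B2 M Y R l) (t - B)) \<and>
        \<P>(\<omega> in M. Y \<omega> \<le> - t) \<le> log_bound_weak c (\<sigma>\<^sup>2 + B2 M Y R l) (t - B))"
proof -
  interpret prob_space M by fact
  interpret approx_zero_bias_pair M Y Ys R r \<sigma> l
    by unfold_locales (use assms in auto)
  have K: "0 < K" using \<open>\<sigma>\<^sup>2 > 0\<close> l_pos by (simp add: B2_def add_pos_nonneg)
  show ?thesis
  proof (intro conjI allI impI; elim conjE)
    fix c \<alpha> B t :: real
    assume "0 < t" "0 < c" "\<alpha> = 1 / c" "AE \<omega> in M. Ys \<omega> - Y \<omega> \<le> c"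
      "\<forall>s\<in>{0..<\<alpha>}. mgf M Y s < \<infinity>" "0 \<le> B" "B1 M Y R l {0<..<\<alpha>} = ennreal B"
    then show "\<P>(\<omega> in M. Y \<omega> \<ge> t) \<le> exp (- (t * (t - 2 * B) / (2 * (K + c * t))))"
      by (intro bernstein_bound_from_exponential_bounds K right_tail_exponential_bound[where \<alpha> = \<alpha>]) auto
  next
    fix c \<alpha> B t :: real
    assume "0 < t" "0 < c" "\<alpha> = 1 / c" "AE \<omega> in M. Y \<omega> - Ys \<omega> \<le> c"
      "\<forall>s\<in>{-\<alpha><..0}. mgf M Y s < \<infinity>" "0 \<le> B" "B1 M Y R l {-\<alpha><..<0} = ennreal B"
    then show "\<P>(\<omega> in M. Y \<omega> \<le> - t) \<le> exp (- (t * (t - 2 * B) / (2 * (K + c * t))))"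
      by (intro bernstein_bound_from_exponential_bounds K left_tail_exponential_bound[where \<alpha> = \<alpha>]) auto
  next
    fix c \<alpha> B t :: real
    assume "0 < t" "0 < c" "\<alpha> = 2 / c" "AE \<omega> in M. \<bar>Ys \<omega> - Y \<omega>\<bar> \<le> c"
      "\<forall>s\<in>{0..<\<alpha>}. mgf M Y s < \<infinity>" "0 \<le> B" "B1 M Y R l {0<..<\<alpha>} = ennreal B"
    then show "\<P>(\<omega> in M. Y \<omega> \<ge> t) \<le> exp (- (t * (t - 2 * B) / (10 * K / 3 + c * t)))"
      by (intro bernstein_pade_bound_from_exponential_bounds K right_tail_exponential_bound[where \<alpha> = \<alpha>])
        (auto simp: abs_le_iff)
  next
    fix c \<alpha> B t :: real
    assume "0 < t" "0 < c" "\<alpha> = 2 / c" "AE \<omega> in M. Y \<omega> - Ys \<omega> \<le> c"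
      "\<forall>s\<in>{-\<alpha><..0}. mgf M Y s < \<infinity>" "0 \<le> B" "B1 M Y R l {-\<alpha><..<0} = ennreal B"
    then show "\<P>(\<omega> in M. Y \<omega> \<le> - t) \<le> exp (- (t * (t - 2 * B) / (10 * K / 3 + c * t)))"
      by (intro bernstein_pade_bound_from_exponential_bounds K left_tail_exponential_bound[where \<alpha> = \<alpha>]) auto
  next
    \<comment> \<open>The comparison of the two logarithmic bounds occurs once for each tail.\<close>
    fix c \<alpha> B t :: real
    assume "0 < c" "1 < t - B"
    then show "log_bound c K (t - B) \<le> log_bound_weak c K (t - B)"
      and "log_bound c K (t - B) \<le> log_bound_weak c K (t - B)"
      by (intro log_bound_le_log_bound_weak; simp)+
  next
    fix c \<alpha> B t :: real
    assume "0 < c" "B < t" "\<alpha> = log_alpha c (t - B)" "AE \<omega> in M. Ys \<omega> - Y \<omega> \<le> c"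
      "mgf M Y \<alpha> < \<infinity>" "0 \<le> B" "B1 M Y R l {0<..<\<alpha>} = ennreal B"
    note bound = right_tail_exponential_bound_if_mgf_at_endpoint[OF this(1,4-7), of _ t, unfolded this(3)]
    show "\<P>(\<omega> in M. Y \<omega> \<ge> t) \<le> log_bound c K (t - B)" if "exp (1 / 2) \<le> t - B"
      using \<open>0 < c\<close> K that bound by (rule log_bound_from_exponential_bounds)
    show "\<P>(\<omega> in M. Y \<omega> \<ge> t) \<le> log_bound_weak c K (t - B)"
      using \<open>0 < c\<close> K _ _ bound by (rule log_bound_weak_from_exponential_bounds) (use \<open>B < t\<close> in auto)
  next
    fix c \<alpha> B t :: real
    assume "0 < c" "B < t" "\<alpha> = log_alpha c (t - B)" "AE \<omega> in M. Y \<omega> - Ys \<omega> \<le> c"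
      "mgf M Y (- \<alpha>) < \<infinity>" "0 \<le> B" "B1 M Y R l {-\<alpha><..<0} = ennreal B"
    note bound = left_tail_exponential_bound_if_mgf_at_endpoint[OF this(1,4-7), of _ t, unfolded this(3)]
    show "\<P>(\<omega> in M. Y \<omega> \<le> - t) \<le> log_bound c K (t - B)" if "exp (1 / 2) \<le> t - B"
      using \<open>0 < c\<close> K that bound by (rule log_bound_from_exponential_bounds)
    show "\<P>(\<omega> in M. Y \<omega> \<le> - t) \<le> log_bound_weak c K (t - B)"
      using \<open>0 < c\<close> K _ _ bound by (rule log_bound_weak_from_exponential_bounds) (use \<open>B < t\<close> in auto)
  qed
qed

end
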